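(* Let $\mathcal{B}$ be a unital ring and let $\mathcal{M}$ be a unital abelian (i.e. commutative) subring of $\mathcal{B}$. The following are equivalent: (1) $\mathcal{M}=(\mathcal{M},\mathcal{B})''$. (2) $\mathcal{M}$ is an intersection of maximal abelian subrings of $\mathcal{B}$. (3) $\mathcal{M}$ is an intersection of subrings of the form $(\mathcal{S},\mathcal{B})'$ for subsets $\mathcal{S}$ of $\mathcal{B}$.
   Context: A unital subring of $\mathcal{B}$ contains the identity of $\mathcal{B}$. For a subset $\mathcal{S}$ of a ring $\mathcal{B}$, the relative commutant is $(\mathcal{S},\mathcal{B})'=\{T\in\mathcal{B}: TS=ST \text{ for all } S\in\mathcal{S}\}$ and the relative double commutant is $(\mathcal{S},\mathcal{B})''=\{T\in\mathcal{B}: TA=AT \text{ for all } A\in(\mathcal{S},\mathcal{B})'\}$. A maximal abelian subring of $\mathcal{B}$ is a commutative subring not properly contained in any other commutative subring of $\mathcal{B}$. *)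

theory Defs
  imports "HOL-Algebra.Algebra"
begin

definition rel_commutant :: "('a, 'b) ring_scheme \<Rightarrow> 'a set \<Rightarrow> 'a set" where
  "rel_commutant B S = {T \<in> carrier B. \<forall>A\<in>S. T \<otimes>\<^bsub>B\<^esub> A = A \<otimes>\<^bsub>B\<^esub> T}"

definition rel_double_commutant :: "('a, 'b) ring_scheme \<Rightarrow> 'a set \<Rightarrow> 'a set" where
  "rel_double_commutant B S =
     {T \<in> carrier B. \<forall>A\<in>rel_commutant B S. T \<otimes>\<^bsub>B\<^esub> A = A \<otimes>\<^bsub>B\<^esub> T}"

(* The library predicates subring and subcring require the identity of the ambient
   ring to be a member. Maximality of an abelian subring is meant among all commutative
   subrings, unital or not, so the identity is not required here. *)
definition abelian_subring :: "'a set \<Rightarrow> ('a, 'b) ring_scheme \<Rightarrow> bool" where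
  "abelian_subring A B \<longleftrightarrow>
     additive_subgroup A B \<and>
     (\<forall>x\<in>A. \<forall>y\<in>A. x \<otimes>\<^bsub>B\<^esub> y \<in> A) \<and>
     (\<forall>x\<in>A. \<forall>y\<in>A. x \<otimes>\<^bsub>B\<^esub> y = y \<otimes>\<^bsub>B\<^esub> x)"

definition maximal_abelian_subring :: "'a set \<Rightarrow> ('a, 'b) ring_scheme \<Rightarrow> bool" where
  "maximal_abelian_subring A B \<longleftrightarrow>
     abelian_subring A B \<and> \<not> (\<exists>C. abelian_subring C B \<and> A \<subset> C)"

lemma subcring_iff_unital_abelian_subring:
  "subcring M B \<longleftrightarrow> abelian_subring M B \<and> \<one>\<^bsub>B\<^esub> \<in> M"
  by (auto simp: subcring_def subcring_axioms_def subring_def abelian_subring_def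
      additive_subgroup_def submonoid_def subgroup_def)

end

theory Submission
  imports Defs
begin

text \<open>
  A maximal pairwise commuting subset of \<open>B\<close> equals its own commutant, hence is a subring; so Zorn's
  lemma puts every commuting set inside a maximal abelian subring, and these are exactly the
  self-commutant sets. If \<open>T\<close> commutes with \<open>M\<close>, then \<open>M \<union> {T}\<close> is a commuting set, so an element
  of all maximal abelian subrings containing \<open>M\<close> commutes with \<open>T\<close>, i.e. lies in the double
  commutant of \<open>M\<close>. The converse direction is the Galois connection of commutants.
\<close>

text \<open>Closure under the ring operations is left out on purpose: unions of chains and one-point
  extensions then stay in the class with no need to generate a subring. Maximal members regain
  closure by being commutants.\<close>

definition commuting_set :: "('a, 'b) ring_scheme \<Rightarrow> 'a set \<Rightarrow> bool" where
  "commuting_set B S \<longleftrightarrow>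
     S \<subseteq> carrier B \<and> (\<forall>x\<in>S. \<forall>y\<in>S. x \<otimes>\<^bsub>B\<^esub> y = y \<otimes>\<^bsub>B\<^esub> x)"

lemma rel_double_commutant_eq:
  "rel_double_commutant B S = rel_commutant B (rel_commutant B S)"
  by (simp add: rel_double_commutant_def rel_commutant_def)

lemma rel_commutant_subset_carrier: "rel_commutant B S \<subseteq> carrier B"
  by (auto simp: rel_commutant_def)

lemma rel_commutant_antimono: "S \<subseteq> T \<Longrightarrow> rel_commutant B T \<subseteq> rel_commutant B S"
  by (auto simp: rel_commutant_def)

lemma subset_rel_double_commutant:
  "S \<subseteq> carrier B \<Longrightarrow> S \<subseteq> rel_commutant B (rel_commutant B S)"
  by (auto simp: rel_commutant_def)

text \<open>Write ' for the commutant. Reversing inclusions twice suffices: M \<subseteq> S' gives S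
  \<subseteq> S'' \<subseteq> M', and hence M'' \<subseteq> S'.\<close>

lemma rel_double_commutant_of_rel_commutant_subset:
  assumes "S \<subseteq> carrier B" "M \<subseteq> rel_commutant B S"
  shows "rel_double_commutant B M \<subseteq> rel_commutant B S"
  using assms unfolding rel_double_commutant_eq
  by (meson rel_commutant_antimono subset_rel_double_commutant subset_trans)

lemma commuting_set_iff_subset_rel_commutant:
  "commuting_set B S \<longleftrightarrow> S \<subseteq> rel_commutant B S"
  by (auto simp: commuting_set_def rel_commutant_def)

lemma commuting_set_insert:
  assumes "commuting_set B S" "x \<in> rel_commutant B S"
  shows "commuting_set B (insert x S)"
  using assms by (auto simp: commuting_set_def rel_commutant_def)

context ring
begin

lemma abelian_subring_imp_commuting_set: "abelian_subring A R \<Longrightarrow> commuting_set R A"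
  by (auto simp: abelian_subring_def commuting_set_def dest: additive_subgroup.a_subset)

lemma additive_subgroup_rel_commutant:
  assumes "S \<subseteq> carrier R"
  shows "additive_subgroup (rel_commutant R S) R"
proof (intro additive_subgroup.intro add.subgroupI)
  show "rel_commutant R S \<subseteq> carrier R"
    by (rule rel_commutant_subset_carrier)
  have "\<zero> \<in> rel_commutant R S"
    using assms by (auto simp: rel_commutant_def subset_iff)
  then show "rel_commutant R S \<noteq> {}" by blast
next
  fix a assume "a \<in> rel_commutant R S"
  then show "\<ominus> a \<in> rel_commutant R S"
    using assms by (auto simp: rel_commutant_def subset_iff l_minus r_minus)
next
  fix a b assume "a \<in> rel_commutant R S" "b \<in> rel_commutant R S"
  then show "a \<oplus> b \<in> rel_commutant R S"
    using assms by (auto simp: rel_commutant_def subset_iff l_distr r_distr)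
qed

lemma rel_commutant_mult_closed:
  assumes "S \<subseteq> carrier R" "x \<in> rel_commutant R S" "y \<in> rel_commutant R S"
  shows "x \<otimes> y \<in> rel_commutant R S"
proof -
  have "(x \<otimes> y) \<otimes> s = s \<otimes> (x \<otimes> y)" if "s \<in> S" for s
  proof -
    have c: "x \<in> carrier R" "y \<in> carrier R" "s \<in> carrier R"
      and e: "x \<otimes> s = s \<otimes> x" "y \<otimes> s = s \<otimes> y"
      using assms that by (auto simp: rel_commutant_def)
    have "(x \<otimes> y) \<otimes> s = x \<otimes> (s \<otimes> y)" using c e by (simp add: m_assoc)
    also have "\<dots> = (s \<otimes> x) \<otimes> y" using c e by (simp flip: m_assoc)
    finally show ?thesis using c by (simp add: m_assoc)
  qed
  then show ?thesis using assms by (auto simp: rel_commutant_def)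
qed

text \<open>Being a commutant makes \<open>C\<close> a subring, and lying in its own commutant makes
  it commutative. Any abelian subring \<open>D\<close> above \<open>C\<close> commutes with all of
  \<open>C\<close>, so it falls into the commutant of \<open>C\<close>, which is
  \<open>C\<close>.\<close>

lemma self_commutant_imp_maximal_abelian_subring:
  assumes "C = rel_commutant R C"
  shows "maximal_abelian_subring C R"
proof -
  have sub: "C \<subseteq> carrier R"
    using assms rel_commutant_subset_carrier by metis
  have "abelian_subring C R"
    unfolding abelian_subring_def
  proof (intro conjI ballI)
    show "additive_subgroup C R"
      using additive_subgroup_rel_commutant[OF sub] by (simp flip: assms)
    show "x \<otimes> y \<in> C" if "x \<in> C" "y \<in> C" for x y
      using rel_commutant_mult_closed[OF sub] that assms by blast
    show "x \<otimes> y = y \<otimes> x" if "x \<in> C" "y \<in> C" for x y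
    proof -
      have "x \<in> rel_commutant R C" using that assms by blast
      then show ?thesis using that by (simp add: rel_commutant_def)
    qed
  qed
  moreover have "D \<subseteq> C" if "abelian_subring D R" "C \<subseteq> D" for D
  proof -
    have "D \<subseteq> rel_commutant R D"
      using abelian_subring_imp_commuting_set[OF that(1)]
      by (simp add: commuting_set_iff_subset_rel_commutant)
    also have "\<dots> \<subseteq> rel_commutant R C"
      using that(2) by (rule rel_commutant_antimono)
    finally show ?thesis by (simp flip: assms)
  qed
  ultimately show ?thesis
    unfolding maximal_abelian_subring_def by blast
qed

text \<open>Zorn's lemma runs over commuting sets above \<open>S\<close>, not over subrings. The
  equation for \<open>C\<close> is exported too, since it is what later yields the same equation for
  every maximal abelian subring.\<close>

lemma commuting_set_in_maximal_abelian_subring: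
  assumes "commuting_set R S"
  obtains C where "S \<subseteq> C" "maximal_abelian_subring C R" "C = rel_commutant R C"
proof -
  define \<A> where "\<A> = {T. commuting_set R T \<and> S \<subseteq> T}"
  have "\<exists>C\<in>\<A>. \<forall>D\<in>\<A>. C \<subseteq> D \<longrightarrow> D = C"
  proof (rule subset_Zorn_nonempty)
    show "\<A> \<noteq> {}" using assms by (auto simp: \<A>_def)
    fix \<C> assume ne: "\<C> \<noteq> {}" and ch: "subset.chain \<A> \<C>"
    have members: "commuting_set R D" "S \<subseteq> D" if "D \<in> \<C>" for D
      using ch that by (auto simp: subset_chain_def \<A>_def)
    have "x \<otimes> y = y \<otimes> x" if xy: "x \<in> \<Union>\<C>" "y \<in> \<Union>\<C>" for x y
    proof -
      \<comment> \<open>Two members of a chain are comparable, so the larger one contains both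
        \<open>x\<close> and \<open>y\<close>.\<close>
      obtain D E where "D \<in> \<C>" "E \<in> \<C>" "x \<in> D" "y \<in> E"
        using xy by blast
      moreover from this have "D \<subseteq> E \<or> E \<subseteq> D"
        using ch by (auto simp: subset_chain_def)
      ultimately obtain K where "K \<in> \<C>" "x \<in> K" "y \<in> K" by blast
      then show ?thesis
        using members by (auto simp: commuting_set_def)
    qed
    moreover have "\<Union>\<C> \<subseteq> carrier R"
      using members by (auto simp: commuting_set_def)
    moreover have "S \<subseteq> \<Union>\<C>"
      using ne members by (meson Sup_upper2 ex_in_conv)
    ultimately show "\<Union>\<C> \<in> \<A>" by (simp add: \<A>_def commuting_set_def)
  qed
  then obtain C where "C \<in> \<A>" and C_max: "\<forall>D\<in>\<A>. C \<subseteq> D \<longrightarrow> D = C"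
    by (elim bexE)
  then have C: "commuting_set R C" "S \<subseteq> C" by (simp_all add: \<A>_def)
  have "rel_commutant R C \<subseteq> C"
  proof
    \<comment> \<open>An element commuting with all of \<open>C\<close> can be adjoined to it, so
      maximality already puts it in \<open>C\<close>.\<close>
    fix x assume "x \<in> rel_commutant R C"
    then have "insert x C \<in> \<A>"
      using C by (auto simp: \<A>_def intro: commuting_set_insert)
    then have "insert x C = C" by (rule C_max[rule_format]) (rule subset_insertI)
    then show "x \<in> C" by (metis insertI1)
  qed
  moreover have "C \<subseteq> rel_commutant R C"
    using C(1) by (simp add: commuting_set_iff_subset_rel_commutant)
  ultimately have fixed: "C = rel_commutant R C" by (intro equalityI)
  show thesis
    by (rule that[OF C(2) self_commutant_imp_maximal_abelian_subring[OF fixed] fixed])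
qed

text \<open>Adjoining to \<open>A\<close> an element of its commutant gives only a commuting set, to
  which maximality among subrings does not apply. Instead \<open>A\<close> is enlarged to a
  self-commutant abelian subring, with which it must coincide.\<close>

lemma maximal_abelian_subring_imp_self_commutant:
  assumes "maximal_abelian_subring A R"
  shows "A = rel_commutant R A"
proof -
  have "commuting_set R A"
    using assms abelian_subring_imp_commuting_set by (simp add: maximal_abelian_subring_def)
  then obtain C where "A \<subseteq> C" "maximal_abelian_subring C R" "C = rel_commutant R C"
    by (rule commuting_set_in_maximal_abelian_subring)
  moreover from this have "A = C"
    using assms unfolding maximal_abelian_subring_def by blast
  ultimately show ?thesis by blast
qed

text \<open>The subring \<open>C\<close> used in the proof depends on \<open>T\<close>, which is why
  the intersection runs over all maximal abelian subrings containing \<open>M\<close>.\<close>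

lemma Inter_maximal_abelian_subrings_subset:
  assumes "commuting_set R M"
  shows "\<Inter>{A. maximal_abelian_subring A R \<and> M \<subseteq> A} \<subseteq> rel_double_commutant R M"
proof
  fix x assume x: "x \<in> \<Inter>{A. maximal_abelian_subring A R \<and> M \<subseteq> A}"
  have commutes: "x \<in> carrier R \<and> x \<otimes> T = T \<otimes> x" if T: "T \<in> rel_commutant R M" for T
  proof -
    obtain C where "insert T M \<subseteq> C" "maximal_abelian_subring C R" "C = rel_commutant R C"
      using commuting_set_in_maximal_abelian_subring[OF commuting_set_insert[OF assms T]] .
    then have "x \<in> rel_commutant R C" "T \<in> C" using x by blast+
    then show ?thesis by (simp add: rel_commutant_def)
  qed
  \<comment> \<open>Some element of the commutant is required to extract
    \<open>x \<in> carrier R\<close> from \<open>commutes\<close>; zero always serves.\<close>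
  moreover have "\<zero> \<in> rel_commutant R M"
    using assms by (auto simp: rel_commutant_def commuting_set_def subset_iff)
  ultimately show "x \<in> rel_double_commutant R M"
    by (auto simp: rel_double_commutant_def)
qed

end

theorem lemma1:
  fixes B :: "('a, 'b) ring_scheme" and M :: "'a set"
  assumes "ring B"
    and "subcring M B"
  shows "(M = rel_double_commutant B M \<longleftrightarrow>
           (\<exists>F. F \<noteq> {} \<and> (\<forall>A\<in>F. maximal_abelian_subring A B) \<and> M = \<Inter>F)) \<and>
         ((\<exists>F. F \<noteq> {} \<and> (\<forall>A\<in>F. maximal_abelian_subring A B) \<and> M = \<Inter>F) \<longleftrightarrow>
           (\<exists>F. F \<noteq> {} \<and> (\<forall>A\<in>F. \<exists>S\<subseteq>carrier B. A = rel_commutant B S) \<and> M = \<Inter>F))"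
proof -
  interpret ring B by fact
  let ?one = "M = rel_double_commutant B M"
  let ?two = "\<exists>F. F \<noteq> {} \<and> (\<forall>A\<in>F. maximal_abelian_subring A B) \<and> M = \<Inter>F"
  let ?three = "\<exists>F. F \<noteq> {} \<and> (\<forall>A\<in>F. \<exists>S\<subseteq>carrier B. A = rel_commutant B S) \<and> M = \<Inter>F"
  have M: "commuting_set B M"
    using assms(2) abelian_subring_imp_commuting_set
    by (simp add: subcring_iff_unital_abelian_subring)
  then have M_carrier: "M \<subseteq> carrier B" by (simp add: commuting_set_def)
  \<comment> \<open>The equivalences follow from a cycle: (1) to (2) to (3) and back to (1).\<close>
  have "?two" if "?one"
  proof -
    define F where "F = {A. maximal_abelian_subring A B \<and> M \<subseteq> A}"
    have "F \<noteq> {}"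
      using commuting_set_in_maximal_abelian_subring[OF M] unfolding F_def
      by (metis (mono_tags, lifting) empty_iff mem_Collect_eq)
    moreover have "\<forall>A\<in>F. maximal_abelian_subring A B" by (simp add: F_def)
    moreover have "M = \<Inter>F"
    proof (rule equalityI)
      show "\<Inter>F \<subseteq> M"
        using Inter_maximal_abelian_subrings_subset[OF M] unfolding F_def
        by (simp flip: that)
    qed (auto simp: F_def)
    ultimately show ?thesis by blast
  qed
  moreover have "?three" if two: "?two"
  proof -
    \<comment> \<open>The same family \<open>F\<close> works for (3), each member being the
      commutant of itself.\<close>
    have "\<exists>S\<subseteq>carrier B. A = rel_commutant B S" if A: "maximal_abelian_subring A B" for A
    proof (intro exI conjI)
      show "A = rel_commutant B A"
        by (rule maximal_abelian_subring_imp_self_commutant[OF A])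
      then show "A \<subseteq> carrier B"
        using rel_commutant_subset_carrier by metis
    qed
    moreover obtain F where "F \<noteq> {}" "\<forall>A\<in>F. maximal_abelian_subring A B" "M = \<Inter>F"
      using two by blast
    ultimately show ?thesis by (intro exI[of _ F]) blast
  qed
  moreover have "?one" if "?three"
  proof (rule equalityI)
    show "M \<subseteq> rel_double_commutant B M"
      unfolding rel_double_commutant_eq by (rule subset_rel_double_commutant[OF M_carrier])
    from that obtain F where F: "\<forall>A\<in>F. \<exists>S\<subseteq>carrier B. A = rel_commutant B S" "M = \<Inter>F"
      by blast
    \<comment> \<open>A commutant that contains \<open>M\<close> also contains its double commutant;
      intersecting over \<open>F\<close> gives the reverse inclusion.\<close>
    have "rel_double_commutant B M \<subseteq> A" if A: "A \<in> F" for A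
    proof -
      obtain S where S: "S \<subseteq> carrier B" "A = rel_commutant B S" using F(1) A by blast
      moreover have "M \<subseteq> A" using F(2) A by blast
      ultimately show ?thesis
        using rel_double_commutant_of_rel_commutant_subset by metis
    qed
    then show "rel_double_commutant B M \<subseteq> M" using F(2) by blast
  qed
  ultimately show ?thesis by argo
qed

end
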